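(* Let $u\ge0$ be an integer constant, and for each $n$ let $A:\widehat{\mathbb{Z}}^{n+u}\to\widehat{\mathbb{Z}}^n$ be a random $n\times(n+u)$ matrix whose entries are independent and each distributed according to the Haar probability measure on $\widehat{\mathbb{Z}}$. If $u>0$, then \[\lim_{n\to\infty}\mathbb{P}(A\text{ is surjective})=\prod_{k=u+1}^{\infty}\zeta(k)^{-1}.\] If $u=0$, then $\lim_{n\to\infty}\mathbb{P}(A\text{ is surjective})=0$.
   Context: $\widehat{\mathbb{Z}}=\prod_{p\text{ prime}}\mathbb{Z}_p$ is the profinite completion of $\mathbb{Z}$, with its Haar probability measure (the product of the Haar probability measures on the $p$-adic integers $\mathbb{Z}_p$). $\zeta$ is the Riemann zeta function. *)

theory Defs
  imports "HOL-Probability.Probability"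
begin

text \<open>The profinite completion of the integers, realised as the inverse limit of the
  rings Z/mZ (m \<ge> 1): an element is a compatible family of residues f m \<in> {0..<m},
  with f d = f m mod d whenever d divides m (the dummy value f 0 = 0).\<close>
definition Zhat :: "(nat \<Rightarrow> int) set" where
  "Zhat = {f. f 0 = 0 \<and> (\<forall>m>0. 0 \<le> f m \<and> f m < int m)
              \<and> (\<forall>d m. 0 < m \<longrightarrow> d dvd m \<longrightarrow> f d = f m mod int d)}"

definition zadd :: "(nat \<Rightarrow> int) \<Rightarrow> (nat \<Rightarrow> int) \<Rightarrow> (nat \<Rightarrow> int)" where
  "zadd f g = (\<lambda>m. if m = 0 then 0 else (f m + g m) mod int m)"

text \<open>Borel sigma-algebra of the profinite topology: generated by the projections
  to the finite quotients Z/mZ.\<close>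
definition Zhat_borel :: "(nat \<Rightarrow> int) measure" where
  "Zhat_borel = restrict_space (PiM UNIV (\<lambda>_::nat. count_space (UNIV :: int set))) Zhat"

definition haar_Zhat :: "(nat \<Rightarrow> int) measure \<Rightarrow> bool" where
  "haar_Zhat \<mu> \<longleftrightarrow> prob_space \<mu> \<and> sets \<mu> = sets Zhat_borel \<and> space \<mu> = Zhat \<and>
     (\<forall>x\<in>Zhat. \<forall>S\<in>sets \<mu>. emeasure \<mu> (zadd x ` S) = emeasure \<mu> S)"

definition zmatvec :: "nat \<Rightarrow> (nat \<times> nat \<Rightarrow> nat \<Rightarrow> int) \<Rightarrow> (nat \<Rightarrow> nat \<Rightarrow> int) \<Rightarrow> nat \<Rightarrow> nat \<Rightarrow> int" where
  "zmatvec N A x i = (\<lambda>m. if m = 0 then 0 else (\<Sum>j<N. A (i, j) m * x j m) mod int m)"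

definition zhat_surj :: "nat \<Rightarrow> nat \<Rightarrow> (nat \<times> nat \<Rightarrow> nat \<Rightarrow> int) \<Rightarrow> bool" where
  "zhat_surj n N A \<longleftrightarrow>
     (\<forall>y. (\<forall>i<n. y i \<in> Zhat) \<longrightarrow>
        (\<exists>x. (\<forall>j<N. x j \<in> Zhat) \<and> (\<forall>i<n. zmatvec N A x i = y i)))"

text \<open>Riemann zeta at an integer k (used only for k \<ge> 2, where the series converges).\<close>
definition zeta_nat :: "nat \<Rightarrow> real" where
  "zeta_nat k = (\<Sum>n. 1 / real (Suc n) ^ k)"

definition surj_prob :: "(nat \<Rightarrow> int) measure \<Rightarrow> nat \<Rightarrow> nat \<Rightarrow> real" where
  "surj_prob \<mu> u n =
     measure (PiM ({..<n} \<times> {..<n+u}) (\<lambda>_. \<mu>))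
       {A \<in> space (PiM ({..<n} \<times> {..<n+u}) (\<lambda>_. \<mu>)). zhat_surj n (n+u) A}"

end

theory Submission
  imports Defs "HOL-Number_Theory.Cong"
begin

text \<open>A matrix over the profinite integers is surjective iff it is surjective modulo every prime:
  surjectivity modulo \<open>a\<close> and modulo \<open>b\<close> gives surjectivity modulo \<open>ab\<close>, and solutions modulo
  \<open>k!\<close> can be lifted compatibly. Reduction modulo \<open>m\<close> sends Haar measure to the uniform measure
  on residues, so the probability of being surjective modulo all primes \<open>p \<le> k\<close> is found by
  counting; pivoting on a nonzero entry of the last row shows that over a prime field there are
  \<open>(p^N - 1) \<cdots> (p^N - p^(n-1))\<close> surjective matrices of size \<open>n \<times> N\<close>. Letting \<open>k\<close> tend to
  infinity, the Euler product turns this into a finite product of inverse zeta values, except that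
  the factor for \<open>\<zeta>(1)\<close>, which occurs only if \<open>u = 0\<close>, vanishes by divergence of the harmonic
  series.\<close>

section \<open>Surjectivity modulo primes\<close>

text \<open>Columns range over an arbitrary index set \<open>J\<close>, not an initial segment, so
  that the pivoting argument can delete any column without renumbering. Vectors are total integer
  functions, of which only the values on \<open>J\<close> and below \<open>n\<close> matter.\<close>

definition surj_mod :: "nat \<Rightarrow> nat \<Rightarrow> nat set \<Rightarrow> (nat \<times> nat \<Rightarrow> int) \<Rightarrow> bool" where
  "surj_mod m n J M \<longleftrightarrow>
     (\<forall>y. \<exists>x. \<forall>i<n. [(\<Sum>j\<in>J. M (i, j) * x j) = y i] (mod int m))"

lemma cong_sum_scaled:
  assumes "\<And>j. j \<in> J \<Longrightarrow> [a j = b j] (mod m)"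
  shows "[(\<Sum>j\<in>J. a j * x j) = (\<Sum>j\<in>J. b j * x j :: int)] (mod m)"
  using assms by (intro cong_sum cong_scalar_right)

lemma surj_modD:
  assumes "surj_mod m n J M"
  obtains x where "\<forall>i<n. [(\<Sum>j\<in>J. M (i, j) * x j) = y i] (mod int m)"
  using assms unfolding surj_mod_def by blast

lemma surj_mod_cong:
  assumes "\<And>i j. i < n \<Longrightarrow> j \<in> J \<Longrightarrow> [M (i, j) = M' (i, j)] (mod int m)"
  shows "surj_mod m n J M \<longleftrightarrow> surj_mod m n J M'"
proof -
  have "[(\<Sum>j\<in>J. M (i, j) * x j) = (\<Sum>j\<in>J. M' (i, j) * x j)] (mod int m)" if "i < n" for i x
    using assms that by (intro cong_sum_scaled) auto
  then show ?thesis
    unfolding surj_mod_def by (meson cong_sym cong_trans)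
qed

lemma surj_mod_dvd:
  assumes "surj_mod m n J M" "d dvd m"
  shows "surj_mod d n J M"
  using assms unfolding surj_mod_def by (meson cong_dvd_modulus of_nat_dvd_iff)

text \<open>The form of Nakayama's lemma needed here; \<open>a\<close> and \<open>b\<close> need not be coprime.\<close>

lemma solve_mod_mult:
  assumes x: "\<forall>i<n. [(\<Sum>j\<in>J. M (i, j) * x j) = y i] (mod int a)"
    and "surj_mod b n J M"
  obtains z where "\<forall>i<n. [(\<Sum>j\<in>J. M (i, j) * z j) = y i] (mod int (a * b))"
    and "\<forall>j. [z j = x j] (mod int a)"
proof -
  \<comment> \<open>The error of \<open>x\<close> is a multiple \<open>a * e\<close> of the first
    modulus. Solving for \<open>e\<close> modulo \<open>b\<close> gives a correction
    \<open>a * w\<close> that leaves \<open>x\<close> unchanged modulo \<open>a\<close>.\<close>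
  have "\<forall>i. \<exists>e. i < n \<longrightarrow> y i - (\<Sum>j\<in>J. M (i, j) * x j) = int a * e"
    using x by (meson cong_iff_dvd_diff cong_sym dvdE)
  then obtain e where e: "\<And>i. i < n \<Longrightarrow> y i - (\<Sum>j\<in>J. M (i, j) * x j) = int a * e i"
    by metis
  obtain w where w: "\<forall>i<n. [(\<Sum>j\<in>J. M (i, j) * w j) = e i] (mod int b)"
    by (rule surj_modD[OF assms(2), where y = e])
  have "[(\<Sum>j\<in>J. M (i, j) * (x j + int a * w j)) = y i] (mod int (a * b))" if i: "i < n" for i
  proof -
    have "(\<Sum>j\<in>J. M (i, j) * (x j + int a * w j)) - y i
        = int a * ((\<Sum>j\<in>J. M (i, j) * w j) - e i)"
      using e[OF i] by (simp add: algebra_simps sum.distrib sum_distrib_left)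
    then show ?thesis
      using w i by (simp add: cong_iff_dvd_diff)
  qed
  then show thesis
    by (intro that[of "\<lambda>j. x j + int a * w j"]) (simp_all add: cong_iff_dvd_diff)
qed

lemma surj_mod_mult:
  assumes "surj_mod a n J M" "surj_mod b n J M"
  shows "surj_mod (a * b) n J M"
  unfolding surj_mod_def
proof
  fix y
  obtain x where x: "\<forall>i<n. [(\<Sum>j\<in>J. M (i, j) * x j) = y i] (mod int a)"
    by (rule surj_modD[OF assms(1), where y = y])
  obtain z where "\<forall>i<n. [(\<Sum>j\<in>J. M (i, j) * z j) = y i] (mod int (a * b))"
    by (rule solve_mod_mult[where M = M and y = y, OF x assms(2)])
  then show "\<exists>x. \<forall>i<n. [(\<Sum>j\<in>J. M (i, j) * x j) = y i] (mod int (a * b))"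
    by blast
qed

lemma surj_mod_one: "surj_mod (Suc 0) n J M"
  by (simp add: surj_mod_def)

lemma surj_mod_mult_iff: "surj_mod (a * b) n J M \<longleftrightarrow> surj_mod a n J M \<and> surj_mod b n J M"
  using surj_mod_mult surj_mod_dvd by (meson dvd_triv_left dvd_triv_right)

text \<open>Split off one prime factor at a time with \<open>surj_mod_mult\<close>. As that lemma
  accepts factors with a common divisor, prime powers are covered by the same induction.\<close>

lemma surj_mod_primeI:
  assumes "m > 0" "\<And>p. prime p \<Longrightarrow> p dvd m \<Longrightarrow> surj_mod p n J M"
  shows "surj_mod m n J M"
  using assms
proof (induction m rule: less_induct)
  case (less m)
  show ?case
  proof (cases "m = 1")
    case False
    then obtain p where p: "prime p" "p dvd m"
      using prime_factor_nat by blast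
    then obtain k where k: "m = p * k" by blast
    then have "0 < k" "k < m"
      using p prime_gt_1_nat[OF p(1)] less.prems(1) by auto
    then have "surj_mod k n J M"
      using less k by (meson dvd_mult)
    then show ?thesis
      using surj_mod_mult less.prems(2) p k by blast
  qed (simp add: surj_mod_one)
qed

section \<open>Passage between the profinite integers and their finite quotients\<close>

lemma Zhat_cong:
  assumes "f \<in> Zhat" "m > 0" "d dvd m"
  shows "[f m = f d] (mod int d)"
proof -
  have "f d = f m mod int d"
    using assms unfolding Zhat_def by blast
  then show ?thesis by (simp add: cong_def)
qed

lemma Zhat_bounds:
  assumes "f \<in> Zhat" "m > 0"
  shows "f m \<in> {0..<int m}"
proof -
  have "0 \<le> f m \<and> f m < int m" using assms unfolding Zhat_def by blast
  then show ?thesis by simp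
qed

lemma Zhat_mod_self: "f \<in> Zhat \<Longrightarrow> m > 0 \<Longrightarrow> f m mod int m = f m"
  using Zhat_bounds[of f m] by simp

lemma Zhat_zero: "f \<in> Zhat \<Longrightarrow> f 0 = 0"
  unfolding Zhat_def by blast

lemma surj_mod_level:
  assumes "\<And>i j. i < n \<Longrightarrow> j \<in> J \<Longrightarrow> A (i, j) \<in> Zhat" "m > 0" "d dvd m"
  shows "surj_mod d n J (\<lambda>s. A s m) \<longleftrightarrow> surj_mod d n J (\<lambda>s. A s d)"
  using assms by (intro surj_mod_cong Zhat_cong) auto

text \<open>The canonical embedding of the integers. It supplies profinite right-hand sides with
  prescribed residues and, later, the translations that move one residue class onto another.\<close>

definition zhat_of_int :: "int \<Rightarrow> nat \<Rightarrow> int" where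
  "zhat_of_int a = (\<lambda>m. if m = 0 then 0 else a mod int m)"

lemma zhat_of_int_in_Zhat: "zhat_of_int a \<in> Zhat"
  by (auto simp: zhat_of_int_def Zhat_def mod_mod_cancel)

text \<open>Embed an integral right-hand side by \<open>zhat_of_int\<close>, solve over
  \<open>Zhat\<close>, and read the solution at level \<open>m\<close>.\<close>

lemma zhat_surj_imp_surj_mod:
  assumes "zhat_surj n N A" "m > 0"
  shows "surj_mod m n {..<N} (\<lambda>s. A s m)"
  unfolding surj_mod_def
proof
  fix y
  obtain x where x: "\<forall>i<n. zmatvec N A x i = zhat_of_int (y i)"
    using assms(1) zhat_of_int_in_Zhat unfolding zhat_surj_def by meson
  have "[(\<Sum>j<N. A (i, j) m * x j m) = y i] (mod int m)" if "i < n" for i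
    using fun_cong[OF x[rule_format, OF that], of m] assms(2)
    by (simp add: zmatvec_def zhat_of_int_def cong_def)
  then show "\<exists>x. \<forall>i<n. [(\<Sum>j<N. A (i, j) m * x j) = y i] (mod int m)"
    by (intro exI[of _ "\<lambda>j. x j m"]) auto
qed

text \<open>Solutions modulo \<open>k!\<close> are lifted along \<open>k\<close>: the factorials are cofinal for divisibility.\<close>

lemma surj_mod_imp_zhat_surj:
  assumes A: "\<And>i j. i < n \<Longrightarrow> j < N \<Longrightarrow> A (i, j) \<in> Zhat"
    and surj: "\<And>m. m > 0 \<Longrightarrow> surj_mod m n {..<N} (\<lambda>s. A s m)"
  shows "zhat_surj n N A"
  unfolding zhat_surj_def
proof (intro allI impI)
  fix y :: "nat \<Rightarrow> nat \<Rightarrow> int" assume y: "\<forall>i<n. y i \<in> Zhat"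
  define sol where "sol m x \<longleftrightarrow> (\<forall>i<n. [(\<Sum>j<N. A (i, j) m * x j) = y i m] (mod int m))" for m x
  have sol_dvd: "sol d x" if "sol m x" "m > 0" "d dvd m" for d m x
    unfolding sol_def
  proof (intro allI impI)
    fix i assume i: "i < n"
    have "[(\<Sum>j<N. A (i, j) d * x j) = (\<Sum>j<N. A (i, j) m * x j)] (mod int d)"
      using A i that by (intro cong_sum_scaled cong_sym[OF Zhat_cong]) auto
    also have "[(\<Sum>j<N. A (i, j) m * x j) = y i m] (mod int d)"
      using that i unfolding sol_def by (meson cong_dvd_modulus of_nat_dvd_iff)
    also have "[y i m = y i d] (mod int d)"
      using y i that by (intro Zhat_cong) auto
    finally show "[(\<Sum>j<N. A (i, j) d * x j) = y i d] (mod int d)" .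
  qed
  have "\<exists>f. \<forall>k. sol (fact k) (f k) \<and> (\<forall>j. [f (Suc k) j = f k j] (mod int (fact k)))"
  proof (rule dependent_nat_choice)
    show "\<exists>x. sol (fact 0) x" by (simp add: sol_def)
  next
    fix x k assume x: "sol (fact k) x"
    let ?M = "fact (Suc k) :: nat"
    have M: "?M = fact k * Suc k" "?M > 0" by (simp_all add: mult.commute)
    \<comment> \<open>The vector \<open>x\<close> solves the system at level \<open>fact k\<close>.
      By compatibility of the entries it also solves, modulo \<open>fact k\<close>, the system with
      entries read at the higher level \<open>?M\<close>, so \<open>solve_mod_mult\<close> can be
      applied to a single integer matrix.\<close>
    have "[(\<Sum>j<N. A (i, j) ?M * x j) = y i ?M] (mod int (fact k))" if i: "i < n" for i
    proof -
      have d: "fact k dvd ?M" unfolding M(1) by (rule dvd_triv_left)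
      have "[(\<Sum>j<N. A (i, j) ?M * x j) = (\<Sum>j<N. A (i, j) (fact k) * x j)] (mod int (fact k))"
        using A i M(2) d by (intro cong_sum_scaled Zhat_cong) auto
      also have "[(\<Sum>j<N. A (i, j) (fact k) * x j) = y i (fact k)] (mod int (fact k))"
        using x i unfolding sol_def by blast
      also have "[y i (fact k) = y i ?M] (mod int (fact k))"
        using y i M(2) d by (intro cong_sym[OF Zhat_cong]) auto
      finally show ?thesis .
    qed
    moreover have "surj_mod (Suc k) n {..<N} (\<lambda>s. A s ?M)"
      using surj[OF M(2)] by (rule surj_mod_dvd) (simp only: M(1) dvd_triv_right)
    ultimately obtain z where "\<forall>i<n. [(\<Sum>j<N. A (i, j) ?M * z j) = y i ?M] (mod int (fact k * Suc k))"
        "\<forall>j. [z j = x j] (mod int (fact k))"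
      using solve_mod_mult[where J = "{..<N}" and M = "\<lambda>s. A s ?M" and y = "\<lambda>i. y i ?M"
          and a = "fact k" and b = "Suc k"] by blast
    then show "\<exists>z. sol ?M z \<and> (\<forall>j. [z j = x j] (mod int (fact k)))"
      unfolding sol_def M(1)[symmetric] by blast
  qed
  then obtain f where f: "\<And>k. sol (fact k) (f k)"
    and step: "\<And>k j. [f (Suc k) j = f k j] (mod int (fact k))"
    by blast
  have lift: "[f m j = f d j] (mod int (fact d))" if "d \<le> m" for d m j
    using that
  proof (induction m rule: dec_induct)
    case (step k)
    have "[f (Suc k) j = f k j] (mod int (fact d))"
      using \<open>\<And>k j. [f (Suc k) j = f k j] (mod int (fact k))\<close> step(1)
      by (meson cong_dvd_modulus fact_dvd of_nat_dvd_iff)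
    then show ?case using step by (meson cong_trans)
  qed simp
  have dvd_fact: "m dvd fact m" if "m > 0" for m :: nat
    using that by (intro dvd_fact) auto
  \<comment> \<open>\<open>f m\<close> solves the system modulo \<open>fact m\<close>, of which
    \<open>m\<close> is a divisor, so its residue modulo \<open>m\<close> can serve as level
    \<open>m\<close> of a profinite solution. Level 0 takes the dummy value that \<open>Zhat\<close>
    prescribes.\<close>
  define X where "X j m = (if m = 0 then 0 else f m j mod int m)" for j m
  have "X j \<in> Zhat" for j
  proof -
    have "X j d = X j m mod int d" if "0 < m" "d dvd m" for d m
    proof -
      have "0 < d" "d \<le> m" using that by (auto intro: dvd_imp_le Nat.gr0I)
      then have "[f m j = f d j] (mod int d)"
        using lift dvd_fact by (meson cong_dvd_modulus of_nat_dvd_iff)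
      then show ?thesis using that \<open>0 < d\<close> by (simp add: cong_def X_def mod_mod_cancel)
    qed
    moreover have "X j 0 = 0" "\<forall>m>0. 0 \<le> X j m \<and> X j m < int m"
      by (simp_all add: X_def)
    ultimately show ?thesis unfolding Zhat_def by blast
  qed
  moreover have "zmatvec N A X i = y i" if i: "i < n" for i
  proof
    fix m
    show "zmatvec N A X i m = y i m"
    proof (cases "m = 0")
      case False
      then have "sol m (f m)"
        by (intro sol_dvd[OF f] dvd_fact) simp_all
      then have "[(\<Sum>j<N. A (i, j) m * f m j) = y i m] (mod int m)"
        using i unfolding sol_def by blast
      moreover have "[(\<Sum>j<N. A (i, j) m * X j m) = (\<Sum>j<N. A (i, j) m * f m j)] (mod int m)"
        using False by (intro cong_sum cong_scalar_left) (auto simp: X_def)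
      ultimately have "[(\<Sum>j<N. A (i, j) m * X j m) = y i m] (mod int m)"
        by (rule cong_trans[rotated])
      moreover have "y i m mod int m = y i m"
        using y i False by (intro Zhat_mod_self) auto
      ultimately show ?thesis using False by (simp add: zmatvec_def cong_def)
    qed (use y i in \<open>auto simp: zmatvec_def Zhat_zero\<close>)
  qed
  ultimately show "\<exists>x. (\<forall>j<N. x j \<in> Zhat) \<and> (\<forall>i<n. zmatvec N A x i = y i)"
    by (intro exI[of _ X]) auto
qed

section \<open>Reduction to the primorials\<close>

text \<open>A single modulus controls all primes up to \<open>k\<close>. The primorials form a chain
  under divisibility, so the corresponding surjectivity conditions get stronger with
  \<open>k\<close>.\<close>

definition primorial :: "nat \<Rightarrow> nat" where
  "primorial k = \<Prod>{p. prime p \<and> p \<le> k}"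

lemma finite_primes_le: "finite {p::nat. prime p \<and> p \<le> k}"
  by (rule finite_subset[of _ "{..k}"]) auto

lemma primorial_pos: "primorial k > 0"
  unfolding primorial_def by (rule prod_pos) (auto dest: prime_gt_0_nat)

lemma primorial_dvd: "k \<le> l \<Longrightarrow> primorial k dvd primorial l"
  unfolding primorial_def by (intro prod_dvd_prod_subset finite_primes_le) auto

lemma prime_dvd_primorial: "prime p \<Longrightarrow> p dvd primorial p"
  unfolding primorial_def using finite_primes_le[of p] by (intro dvd_prodI) auto

text \<open>Every prime \<open>p\<close> divides \<open>primorial p\<close>, so the right-hand side
  gives surjectivity modulo every prime, hence modulo every positive integer, hence over
  \<open>Zhat\<close>. Surjectivity thereby becomes a countable conjunction of conditions, each seen
  at one finite level.\<close>

theorem zhat_surj_iff: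
  assumes A: "\<And>i j. i < n \<Longrightarrow> j < N \<Longrightarrow> A (i, j) \<in> Zhat"
  shows "zhat_surj n N A \<longleftrightarrow>
         (\<forall>k. surj_mod (primorial k) n {..<N} (\<lambda>s. A s (primorial k)))"
proof safe
  show "surj_mod (primorial k) n {..<N} (\<lambda>s. A s (primorial k))" if "zhat_surj n N A" for k
    using zhat_surj_imp_surj_mod[OF that primorial_pos] .
next
  assume *: "\<forall>k. surj_mod (primorial k) n {..<N} (\<lambda>s. A s (primorial k))"
  have "surj_mod p n {..<N} (\<lambda>s. A s p)" if "prime p" for p
  proof -
    have "surj_mod p n {..<N} (\<lambda>s. A s (primorial p))"
      using * prime_dvd_primorial[OF that] surj_mod_dvd by blast
    then show ?thesis
      using surj_mod_level[OF _ primorial_pos prime_dvd_primorial[OF that], of n "{..<N}" A] A by simp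
  qed
  then have "surj_mod m n {..<N} (\<lambda>s. A s m)" if m: "m > 0" for m
    using surj_mod_level[OF _ m, of n "{..<N}" A] A
    by (intro surj_mod_primeI[OF m]) simp
  then show "zhat_surj n N A"
    using surj_mod_imp_zhat_surj A by blast
qed

section \<open>Counting surjective matrices\<close>

text \<open>Clearing row \<open>n\<close> by column operations with a unit pivot in column \<open>j\<close>.\<close>

lemma surj_mod_pivot:
  fixes M :: "nat \<times> nat \<Rightarrow> int"
  assumes "finite J" "j \<in> J" and s: "[s * M (n, j) = 1] (mod int m)"
  shows "surj_mod m (Suc n) J M \<longleftrightarrow>
         surj_mod m n (J - {j}) (\<lambda>(i, k). M (i, k) - s * M (n, k) * M (i, j))"
    (is "_ \<longleftrightarrow> surj_mod m n ?K ?M'")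
proof -
  have split: "(\<Sum>k\<in>J. M (i, k) * x k) = M (i, j) * x j + (\<Sum>k\<in>?K. M (i, k) * x k)" for i x
    using assms(1,2) by (rule sum.remove)
  have reduced: "(\<Sum>k\<in>?K. ?M' (i, k) * x k)
      = (\<Sum>k\<in>?K. M (i, k) * x k) - M (i, j) * s * (\<Sum>k\<in>?K. M (n, k) * x k)" for i x
    by (simp add: algebra_simps sum_subtractf sum_distrib_left)
  have e3: "int m dvd s * M (n, j) - 1"
    using s by (simp add: cong_iff_dvd_diff)
  show ?thesis
  proof
    assume surj: "surj_mod m (Suc n) J M"
    show "surj_mod m n ?K ?M'"
      unfolding surj_mod_def
    proof
      fix y :: "nat \<Rightarrow> int"
      \<comment> \<open>With target 0, row \<open>n\<close> determines the pivot variable modulo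
        \<open>m\<close> as \<open>- s\<close> times the rest of that row; substituting it into the
        other rows gives the reduced system.\<close>
      obtain x where x: "\<forall>i<Suc n. [(\<Sum>k\<in>J. M (i, k) * x k) = (y(n := 0)) i] (mod int m)"
        by (rule surj_modD[OF surj, where y = "y(n := 0)"])
      have "[(\<Sum>k\<in>?K. ?M' (i, k) * x k) = y i] (mod int m)" if i: "i < n" for i
      proof -
        let ?S = "\<Sum>k\<in>?K. M (i, k) * x k" and ?R = "\<Sum>k\<in>?K. M (n, k) * x k"
        have e1: "int m dvd M (i, j) * x j + ?S - y i"
          using x[rule_format, of i] i by (simp add: split cong_iff_dvd_diff)
        have e2: "int m dvd M (n, j) * x j + ?R"
          using x[rule_format, of n] by (simp add: split cong_iff_dvd_diff)
        have "?S - M (i, j) * s * ?R - y i = (M (i, j) * x j + ?S - y i)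
            - M (i, j) * (s * (M (n, j) * x j + ?R) - (s * M (n, j) - 1) * x j)"
          by (simp add: algebra_simps)
        moreover have "int m dvd \<dots>"
          by (intro dvd_diff dvd_mult e1 e2 dvd_mult2[OF e3])
        ultimately show ?thesis
          unfolding reduced cong_iff_dvd_diff by (simp only:)
      qed
      then show "\<exists>x. \<forall>i<n. [(\<Sum>k\<in>?K. ?M' (i, k) * x k) = y i] (mod int m)"
        by blast
    qed
  next
    assume surj: "surj_mod m n ?K ?M'"
    show "surj_mod m (Suc n) J M"
      unfolding surj_mod_def
    proof
      fix y :: "nat \<Rightarrow> int"
      \<comment> \<open>Row \<open>n\<close> will be solved through its pivot variable. The share
        \<open>M (i, j) * s * y n\<close> that this feeds into row \<open>i\<close> is subtracted
        from the target in advance.\<close>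
      obtain x where x: "\<forall>i<n. [(\<Sum>k\<in>?K. ?M' (i, k) * x k) = y i - M (i, j) * s * y n] (mod int m)"
        by (rule surj_modD[OF surj, where y = "\<lambda>i. y i - M (i, j) * s * y n"])
      let ?R = "\<Sum>k\<in>?K. M (n, k) * x k"
      define x' where "x' = x(j := s * (y n - ?R))"
      have x': "(\<Sum>k\<in>J. M (i, k) * x' k)
          = M (i, j) * (s * (y n - ?R)) + (\<Sum>k\<in>?K. M (i, k) * x k)" for i
        unfolding split by (auto simp: x'_def intro: sum.cong)
      have "[(\<Sum>k\<in>J. M (i, k) * x' k) = y i] (mod int m)" if i: "i < Suc n" for i
      proof (cases "i = n")
        case True
        have "(\<Sum>k\<in>J. M (i, k) * x' k) - y i = (s * M (n, j) - 1) * (y n - ?R)"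
          unfolding x' True by (simp add: algebra_simps)
        then show ?thesis
          using e3 by (simp add: cong_iff_dvd_diff)
      next
        case False
        have "(\<Sum>k\<in>J. M (i, k) * x' k) - y i
            = (\<Sum>k\<in>?K. ?M' (i, k) * x k) - (y i - M (i, j) * s * y n)"
          unfolding x' reduced by (simp add: algebra_simps)
        then show ?thesis
          using x i False by (simp only: cong_iff_dvd_diff)
      qed
      then show "\<exists>x. \<forall>i<Suc n. [(\<Sum>k\<in>J. M (i, k) * x k) = y i] (mod int m)"
        by blast
    qed
  qed
qed

definition mats :: "nat \<Rightarrow> nat \<Rightarrow> nat set \<Rightarrow> (nat \<times> nat \<Rightarrow> int) set" where
  "mats m n J = ({..<n} \<times> J) \<rightarrow>\<^sub>E {0..<int m}"

definition surj_mats :: "nat \<Rightarrow> nat \<Rightarrow> nat set \<Rightarrow> (nat \<times> nat \<Rightarrow> int) set" where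
  "surj_mats m n J = {M \<in> mats m n J. surj_mod m n J M}"

lemma finite_mats: "finite J \<Longrightarrow> finite (mats m n J)"
  unfolding mats_def by (intro finite_PiE) auto

lemma finite_surj_mats: "finite J \<Longrightarrow> finite (surj_mats m n J)"
  unfolding surj_mats_def using finite_mats by auto

lemma card_mats: "finite J \<Longrightarrow> card (mats m n J) = m ^ (n * card J)"
  unfolding mats_def by (subst card_PiE) (auto simp: card_cartesian_product)

text \<open>The bijection \<open>F\<close> sends a matrix to its column \<open>j\<close> and the
  matrix left after clearing the last row. The column is free, which gives \<open>m ^ n\<close>, and
  by \<open>surj_mod_pivot\<close> surjectivity depends only on the reduced matrix.\<close>

lemma card_surj_mats_fixed_row:
  fixes r :: "nat \<Rightarrow> int"
  assumes J: "finite J" "j \<in> J" and s: "[s * r j = 1] (mod int m)" and m: "m > 0"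
  shows "card {M \<in> mats m n J. surj_mod m (Suc n) J (\<lambda>(i, k). if i = n then r k else M (i, k))}
       = m ^ n * card (surj_mats m n (J - {j}))"
    (is "card ?A = _")
proof -
  let ?K = "J - {j}" and ?C = "{..<n} \<rightarrow>\<^sub>E {0..<int m}"
  define F where "F M = (\<lambda>i\<in>{..<n}. M (i, j),
    \<lambda>(i, k)\<in>{..<n} \<times> ?K. (M (i, k) - s * r k * M (i, j)) mod int m)" for M :: "nat \<times> nat \<Rightarrow> int"
  \<comment> \<open>The inverse of \<open>F\<close>: put the column \<open>c\<close> back in place
    \<open>j\<close> and undo the column operations.\<close>
  define G where "G = (\<lambda>(c :: nat \<Rightarrow> int, M). \<lambda>(i, k)\<in>{..<n} \<times> J.
    if k = j then c i else (M (i, k) + s * r k * c i) mod int m)"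
  have surj_F: "surj_mod m (Suc n) J (\<lambda>(i, k). if i = n then r k else M (i, k))
      \<longleftrightarrow> surj_mod m n ?K (snd (F M))" for M
  proof -
    let ?E = "\<lambda>(i, k). if i = n then r k else M (i, k)"
    have "surj_mod m (Suc n) J ?E
        \<longleftrightarrow> surj_mod m n ?K (\<lambda>(i, k). ?E (i, k) - s * ?E (n, k) * ?E (i, j))"
      using surj_mod_pivot[OF J, of s ?E n m] s by simp
    also have "\<dots> \<longleftrightarrow> surj_mod m n ?K (snd (F M))"
      by (intro surj_mod_cong) (auto simp: F_def cong_def)
    finally show ?thesis .
  qed
  have G_mats: "G (c, M) \<in> mats m n J" if "c \<in> ?C" "M \<in> mats m n ?K" for c M
    using that m unfolding G_def mats_def by (auto simp: PiE_iff)
  have FG: "F (G (c, M)) = (c, M)" if "c \<in> ?C" "M \<in> mats m n ?K" for c M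
  proof -
    have "fst (F (G (c, M))) = c"
      using that(1) J(2) unfolding F_def G_def
      by (auto simp: fun_eq_iff PiE_def extensional_def restrict_def)
    moreover have "snd (F (G (c, M))) = M"
    proof
      fix ik :: "nat \<times> nat"
      obtain i k where ik: "ik = (i, k)" by (cases ik)
      show "snd (F (G (c, M))) ik = M ik"
      proof (cases "ik \<in> {..<n} \<times> ?K")
        case True
        then have "0 \<le> M (i, k)" "M (i, k) < int m"
          using that(2) ik by (auto simp: mats_def PiE_iff)
        then show ?thesis
          using True J(2) ik unfolding F_def G_def by (simp add: mod_simps)
      next
        case False
        then have "M ik = undefined"
          using that(2) unfolding mats_def by (rule PiE_arb[rotated])
        then show ?thesis
          using False unfolding F_def by (simp add: restrict_def)
      qed
    qed
    ultimately show ?thesis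
      by (metis prod.collapse)
  qed
  have GF: "G (F M) = M" if "M \<in> mats m n J" for M
  proof
    fix ik :: "nat \<times> nat"
    obtain i k where ik: "ik = (i, k)" by (cases ik)
    show "G (F M) ik = M ik"
    proof (cases "ik \<in> {..<n} \<times> J")
      case True
      then have "0 \<le> M (i, k)" "M (i, k) < int m"
        using that ik by (auto simp: mats_def PiE_iff)
      then show ?thesis
        using True ik unfolding F_def G_def by (simp add: mod_simps)
    next
      case False
      then have "M ik = undefined"
        using that unfolding mats_def by (rule PiE_arb[rotated])
      then show ?thesis
        using False unfolding G_def F_def by (simp add: restrict_def)
    qed
  qed
  have F_mats: "F M \<in> ?C \<times> mats m n ?K" if "M \<in> mats m n J" for M
    using that J m unfolding F_def mats_def by (auto simp: PiE_iff)
  have "bij_betw F ?A (?C \<times> surj_mats m n ?K)"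
  proof (rule bij_betw_byWitness[where f' = G])
    show "F ` ?A \<subseteq> ?C \<times> surj_mats m n ?K"
    proof
      fix x assume "x \<in> F ` ?A"
      then obtain M where M: "M \<in> ?A" "x = F M" by blast
      then have "F M \<in> ?C \<times> mats m n ?K" "surj_mod m n ?K (snd (F M))"
        using F_mats surj_F by blast+
      then show "x \<in> ?C \<times> surj_mats m n ?K"
        unfolding M(2) surj_mats_def by (cases "F M") simp
    qed
    show "G ` (?C \<times> surj_mats m n ?K) \<subseteq> ?A"
    proof
      fix x assume "x \<in> G ` (?C \<times> surj_mats m n ?K)"
      then obtain c M where M: "c \<in> ?C" "M \<in> mats m n ?K" "surj_mod m n ?K M" "x = G (c, M)"
        by (auto simp: surj_mats_def)
      then show "x \<in> ?A"
        using G_mats[OF M(1,2)] surj_F[of "G (c, M)"] FG[OF M(1,2)] by simp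
    qed
  qed (use GF FG in \<open>auto simp: surj_mats_def\<close>)
  then have "card ?A = card (?C \<times> surj_mats m n ?K)"
    by (rule bij_betw_same_card)
  also have "\<dots> = m ^ n * card (surj_mats m n ?K)"
    by (simp add: card_cartesian_product card_PiE)
  finally show ?thesis .
qed

text \<open>Classify the matrices by their last row \<open>r\<close>; \<open>F\<close> appends that
  row and \<open>G\<close> splits it off.\<close>

lemma card_surj_mats_Suc:
  assumes "finite J"
  shows "card (surj_mats m (Suc n) J) = (\<Sum>r \<in> J \<rightarrow>\<^sub>E {0..<int m}.
    card {M \<in> mats m n J. surj_mod m (Suc n) J (\<lambda>(i, k). if i = n then r k else M (i, k))})"
    (is "_ = (\<Sum>r \<in> ?R. card (?A r))")
proof -
  define F where "F = (\<lambda>(r :: nat \<Rightarrow> int, M). \<lambda>(i, k)\<in>{..<Suc n} \<times> J. if i = n then r k else M (i, k))"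
  define G where "G M = (\<lambda>k\<in>J. M (n, k), restrict M ({..<n} \<times> J))" for M :: "nat \<times> nat \<Rightarrow> int"
  have surj_F: "surj_mod m (Suc n) J (F (r, M)) \<longleftrightarrow>
      surj_mod m (Suc n) J (\<lambda>(i, k). if i = n then r k else M (i, k))" for r M
    by (rule surj_mod_cong) (simp add: F_def)
  have GF: "G (F (r, M)) = (r, M)" if "r \<in> ?R" "M \<in> mats m n J" for r M
  proof -
    have "fst (G (F (r, M))) = r"
      using that(1) unfolding F_def G_def
      by (auto simp: fun_eq_iff PiE_def extensional_def restrict_def)
    moreover have "snd (G (F (r, M))) = M"
      using that(2) unfolding F_def G_def mats_def
      by (auto simp: fun_eq_iff PiE_def extensional_def restrict_def)
    ultimately show ?thesis
      by (metis prod.collapse)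
  qed
  have FG: "F (G M) = M" if "M \<in> mats m (Suc n) J" for M
    using that unfolding F_def G_def mats_def
    by (auto simp: fun_eq_iff PiE_def extensional_def restrict_def less_Suc_eq)
  have "bij_betw F (Sigma ?R ?A) (surj_mats m (Suc n) J)"
  proof (rule bij_betw_byWitness[where f' = G])
    show "\<forall>a\<in>Sigma ?R ?A. G (F a) = a" using GF by auto
    show "\<forall>M\<in>surj_mats m (Suc n) J. F (G M) = M" using FG by (auto simp: surj_mats_def)
    show "F ` Sigma ?R ?A \<subseteq> surj_mats m (Suc n) J"
    proof safe
      fix r M assume *: "r \<in> ?R" "M \<in> mats m n J"
        "surj_mod m (Suc n) J (\<lambda>(i, k). if i = n then r k else M (i, k))"
      have "F (r, M) \<in> mats m (Suc n) J"
        using *(1,2) unfolding F_def mats_def by (auto simp: PiE_iff less_Suc_eq)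
      then show "F (r, M) \<in> surj_mats m (Suc n) J"
        using * surj_F unfolding surj_mats_def by blast
    qed
    show "G ` surj_mats m (Suc n) J \<subseteq> Sigma ?R ?A"
    proof
      fix x assume "x \<in> G ` surj_mats m (Suc n) J"
      then obtain M where M: "M \<in> mats m (Suc n) J" "surj_mod m (Suc n) J M" "x = G M"
        by (auto simp: surj_mats_def)
      obtain r M' where x: "x = (r, M')" by (cases x)
      have G: "G M = (r, M')" using M(3) x by simp
      have "fst (G M) \<in> ?R" "snd (G M) \<in> mats m n J"
        using M(1) unfolding G_def mats_def by (auto simp: PiE_iff)
      then have r: "r \<in> ?R" "M' \<in> mats m n J" unfolding G by simp_all
      have "surj_mod m (Suc n) J (F (r, M'))"
        using M(2) FG[OF M(1)] G by simp
      then show "x \<in> Sigma ?R ?A"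
        unfolding surj_F x using r by blast
    qed
  qed
  then have "card (surj_mats m (Suc n) J) = card (Sigma ?R ?A)"
    by (simp add: bij_betw_same_card)
  also have "\<dots> = (\<Sum>r \<in> ?R. card (?A r))"
    using assms by (intro card_SigmaI) (auto intro: finite_PiE simp: finite_mats)
  finally show ?thesis .
qed

text \<open>Induction on the number of rows. A zero last row excludes surjectivity. Each of the
  \<open>p ^ card J - 1\<close> nonzero ones has an entry invertible modulo \<open>p\<close> and
  contributes \<open>p ^ n\<close> times the count with one row and one column fewer. If
  \<open>card J < n\<close>, the factor at \<open>i = card J\<close> vanishes, as it should.\<close>

theorem card_surj_mats_prime:
  assumes "prime p" "finite J"
  shows "real (card (surj_mats p n J)) = (\<Prod>i<n. real p ^ card J - real p ^ i)"
  using assms(2)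
proof (induction n arbitrary: J)
  case 0
  have "surj_mats p 0 J = {\<lambda>_. undefined}"
    by (auto simp: surj_mats_def mats_def surj_mod_def)
  then show ?case by simp
next
  case (Suc n J)
  let ?R = "J \<rightarrow>\<^sub>E {0..<int p}" and ?z = "\<lambda>k\<in>J. 0 :: int"
  let ?A = "\<lambda>r. {M \<in> mats p n J. surj_mod p (Suc n) J (\<lambda>(i, k). if i = n then r k else M (i, k))}"
  let ?c = "real p ^ n * (\<Prod>i<n. real p ^ (card J - 1) - real p ^ i)"
  have p: "p > 1" using assms(1) by (rule prime_gt_1_nat)
  have fin: "finite ?R" and card_R: "card ?R = p ^ card J" and z: "?z \<in> ?R"
    using Suc.prems p by (auto intro: finite_PiE simp: card_PiE)
  have "?A ?z = {}"
  proof -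
    have False if M: "surj_mod p (Suc n) J (\<lambda>(i, k). if i = n then ?z k else M (i, k))" for M
    proof -
      \<comment> \<open>A zero row cannot reach the target 1.\<close>
      obtain x where "[(\<Sum>k\<in>J. (case (n, k) of (i, k) \<Rightarrow> if i = n then ?z k else M (i, k)) * x k)
          = 1] (mod int p)"
        using spec[OF M[unfolded surj_mod_def], of "\<lambda>_. 1"] lessI[of n] by blast
      then have "[0 = 1] (mod int p)" by simp
      then show False using p by (auto simp: cong_def)
    qed
    then show ?thesis by blast
  qed
  then have A0: "real (card (?A ?z)) = 0"
    by (metis card.empty of_nat_0)
  have A: "real (card (?A r)) = ?c" if r: "r \<in> ?R - {?z}" for r
  proof -
    have "\<exists>j\<in>J. r j \<noteq> 0"
    proof (rule ccontr)
      assume "\<not> (\<exists>j\<in>J. r j \<noteq> 0)"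
      then have "r = ?z"
        using r by (auto simp: PiE_iff extensional_def fun_eq_iff)
      then show False using r by simp
    qed
    then obtain j where j: "j \<in> J" "r j \<noteq> 0" by blast
    have "r j \<in> {0..<int p}"
      using PiE_mem[of r J "\<lambda>_. {0..<int p}" j] r j(1) by blast
    then have "0 < r j" "r j < int p"
      using j(2) by simp_all
    then have "\<not> int p dvd r j"
      by (simp add: zdvd_not_zless)
    then have "coprime (r j) (int p)"
      using assms(1) prime_imp_coprime[of "int p" "r j"] by (simp add: coprime_commute)
    then obtain s where "[r j * s = 1] (mod int p)"
      using cong_solve_coprime_int by blast
    then have s: "[s * r j = 1] (mod int p)" by (simp add: mult.commute)
    have "card (?A r) = p ^ n * card (surj_mats p n (J - {j}))"
      using card_surj_mats_fixed_row[where m = p and r = r, OF Suc.prems j(1) s] p by simp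
    then show ?thesis
      using Suc.IH[of "J - {j}"] Suc.prems j by simp
  qed
  have "real (card (surj_mats p (Suc n) J)) = (\<Sum>r\<in>?R. real (card (?A r)))"
    unfolding card_surj_mats_Suc[OF Suc.prems] by (rule of_nat_sum)
  also have "\<dots> = real (card (?A ?z)) + (\<Sum>r\<in>?R - {?z}. real (card (?A r)))"
    using fin z by (rule sum.remove)
  also have "\<dots> = 0 + (\<Sum>r\<in>?R - {?z}. ?c)"
    unfolding A0 using A by (intro arg_cong2[where f = "(+)"] sum.cong refl)
  also have "\<dots> = (real p ^ card J - 1) * ?c"
    using fin z card_R p by (simp add: of_nat_diff)
  \<comment> \<open>Without columns both sides contain the factor \<open>p ^ 0 - 1 = 0\<close>.
    Otherwise, spreading \<open>p ^ n\<close> over the \<open>n\<close> factors raises both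
    exponents in each by one, which gives the factors of positive index.\<close>
  also have "\<dots> = (\<Prod>i<Suc n. real p ^ card J - real p ^ i)"
  proof (cases "card J = 0")
    case False
    then obtain N where "card J = Suc N" using not0_implies_Suc by blast
    moreover have "real p ^ n * (\<Prod>i<n. real p ^ N - real p ^ i)
        = (\<Prod>i<n. real p * (real p ^ N - real p ^ i))"
      by (simp add: prod.distrib)
    ultimately show ?thesis
      by (simp add: prod.lessThan_Suc_shift algebra_simps del: prod.lessThan_Suc)
  qed (simp add: prod.lessThan_Suc_shift del: prod.lessThan_Suc)
  finally show ?case .
qed

section \<open>Chinese remainder theorem and densities modulo primorials\<close>

text \<open>Reduce entry by entry: \<open>F\<close> is injective because the moduli are coprime, and
  it hits every pair because both sides have \<open>(a * b) ^ (n * card J)\<close> elements. Under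
  \<open>F\<close>, surjectivity modulo \<open>a * b\<close> means surjectivity in both
  components.\<close>

lemma card_surj_mats_mult:
  assumes ab: "coprime a b" "a > 0" "b > 0" and J: "finite J"
  shows "card (surj_mats (a * b) n J) = card (surj_mats a n J) * card (surj_mats b n J)"
proof -
  let ?S = "{..<n} \<times> J"
  define F where "F M = (\<lambda>s\<in>?S. M s mod int a, \<lambda>s\<in>?S. M s mod int b)" for M :: "nat \<times> nat \<Rightarrow> int"
  have inj: "inj_on F (mats (a * b) n J)"
  proof (rule inj_onI)
    fix M M' assume M: "M \<in> mats (a * b) n J" "M' \<in> mats (a * b) n J" "F M = F M'"
    show "M = M'"
    proof (rule PiE_ext[OF M(1,2)[unfolded mats_def]])
      fix s assume s: "s \<in> ?S"
      have "fst (F M) s = fst (F M') s" "snd (F M) s = snd (F M') s"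
        using M(3) by simp_all
      then have "[M s = M' s] (mod int a)" "[M s = M' s] (mod int b)"
        using s by (simp_all add: F_def cong_def)
      then have "[M s = M' s] (mod int a * int b)"
        using ab(1) by (intro coprime_cong_mult) auto
      moreover have "0 \<le> M s" "M s < int a * int b" "0 \<le> M' s" "M' s < int a * int b"
        using M(1,2) s by (auto simp: mats_def PiE_iff)
      ultimately show "M s = M' s"
        by (metis cong_def mod_pos_pos_trivial)
    qed
  qed
  have F_image: "F ` mats (a * b) n J = mats a n J \<times> mats b n J"
  proof (rule card_subset_eq)
    show "finite (mats a n J \<times> mats b n J)" using J by (simp add: finite_mats)
    show "F ` mats (a * b) n J \<subseteq> mats a n J \<times> mats b n J"
      using ab unfolding F_def mats_def by (auto simp: PiE_iff)
    show "card (F ` mats (a * b) n J) = card (mats a n J \<times> mats b n J)"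
      using J by (simp add: card_image[OF inj] card_cartesian_product card_mats power_mult_distrib)
  qed
  have surj: "M \<in> surj_mats (a * b) n J \<longleftrightarrow> F M \<in> surj_mats a n J \<times> surj_mats b n J"
    if M: "M \<in> mats (a * b) n J" for M
  proof -
    have "surj_mod a n J (fst (F M)) \<longleftrightarrow> surj_mod a n J M"
         "surj_mod b n J (snd (F M)) \<longleftrightarrow> surj_mod b n J M"
      by (intro surj_mod_cong; simp add: F_def cong_def)+
    moreover have "F M \<in> mats a n J \<times> mats b n J" using F_image M by blast
    ultimately show ?thesis
      using M by (cases "F M") (simp add: surj_mats_def surj_mod_mult_iff)
  qed
  have "F ` surj_mats (a * b) n J = surj_mats a n J \<times> surj_mats b n J"
  proof
    show "F ` surj_mats (a * b) n J \<subseteq> surj_mats a n J \<times> surj_mats b n J"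
      using surj by (auto simp: surj_mats_def)
    show "surj_mats a n J \<times> surj_mats b n J \<subseteq> F ` surj_mats (a * b) n J"
    proof
      fix x assume x: "x \<in> surj_mats a n J \<times> surj_mats b n J"
      then have "x \<in> mats a n J \<times> mats b n J" by (auto simp: surj_mats_def)
      then obtain M where M: "M \<in> mats (a * b) n J" "x = F M"
        using F_image by blast
      have "M \<in> surj_mats (a * b) n J"
        using surj[OF M(1)] x unfolding M(2) by (rule iffD2)
      with M(2) show "x \<in> F ` surj_mats (a * b) n J" by (rule image_eqI)
    qed
  qed
  moreover have "inj_on F (surj_mats (a * b) n J)"
    using inj by (rule inj_on_subset) (auto simp: surj_mats_def)
  ultimately show ?thesis
    by (metis card_image card_cartesian_product)
qed

lemma card_surj_mats_squarefree:
  assumes "finite F" "\<And>p. p \<in> F \<Longrightarrow> prime p" "finite J"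
  shows "card (surj_mats (\<Prod>F) n J) = (\<Prod>p\<in>F. card (surj_mats p n J))"
  using assms(1,2)
proof (induction F rule: finite_induct)
  case empty
  have "card (surj_mats (Suc 0) n J) = card (mats (Suc 0) n J)"
    by (simp add: surj_mats_def surj_mod_one)
  then show ?case using assms(3) by (simp add: card_mats)
next
  case (insert q F)
  have "coprime q p" if "p \<in> F" for p
    using that insert by (intro primes_coprime) auto
  then have "coprime q (\<Prod>F)"
    by (auto intro: prod_coprime_right)
  moreover have "q > 0" "\<Prod>F > 0"
    using insert by (auto intro!: prod_pos dest: prime_gt_0_nat)
  ultimately show ?case
    using insert assms(3) by (simp add: card_surj_mats_mult)
qed

text \<open>Dividing \<open>p ^ card J - p ^ i\<close> by \<open>p ^ card J\<close> leaves exponents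
  running through \<open>u + 1, ..., u + n\<close>. Exchanging the products puts the primes inside,
  so each \<open>i\<close> contributes a truncated Euler product for the inverse of zeta at
  \<open>i + u + 1\<close>.\<close>

lemma surj_mats_density_primorial:
  assumes "finite J" "card J = n + u"
  shows "real (card (surj_mats (primorial k) n J)) / real (primorial k) ^ (n * card J)
       = (\<Prod>i<n. \<Prod>p | prime p \<and> p \<le> k. 1 - 1 / real p ^ (i + u + 1))"
proof -
  let ?F = "{p. prime p \<and> p \<le> k}"
  have *: "real (card (surj_mats p n J)) / real p ^ (n * card J)
      = (\<Prod>i<n. 1 - 1 / real p ^ (i + u + 1))" if p: "prime p" for p
  proof -
    have p0: "real p > 0" using p by (simp add: prime_gt_0_nat)
    have "real (card (surj_mats p n J)) / real p ^ (n * card J)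
        = (\<Prod>i<n. (real p ^ card J - real p ^ i) / real p ^ card J)"
      unfolding card_surj_mats_prime[OF p assms(1)] prod_dividef
      by (simp add: power_mult[symmetric] mult.commute)
    also have "\<dots> = (\<Prod>i<n. 1 - 1 / real p ^ ((n - Suc i) + u + 1))"
    proof (rule prod.cong)
      fix i assume "i \<in> {..<n}"
      then have "card J = i + ((n - Suc i) + u + 1)" using assms(2) by simp
      then have "real p ^ card J = real p ^ i * real p ^ ((n - Suc i) + u + 1)"
        by (metis power_add)
      then show "(real p ^ card J - real p ^ i) / real p ^ card J
          = 1 - 1 / real p ^ ((n - Suc i) + u + 1)"
        using p0 by (simp add: field_simps)
    qed simp
    also have "\<dots> = (\<Prod>i<n. 1 - 1 / real p ^ (i + u + 1))"
      by (rule prod.nat_diff_reindex)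
    finally show ?thesis .
  qed
  have "real (card (surj_mats (primorial k) n J)) / real (primorial k) ^ (n * card J)
      = (\<Prod>p\<in>?F. real (card (surj_mats p n J)) / real p ^ (n * card J))"
    unfolding primorial_def
    using card_surj_mats_squarefree[OF finite_primes_le, of k J n] assms(1)
    by (simp add: prod_dividef prod_power_distrib)
  also have "\<dots> = (\<Prod>p\<in>?F. \<Prod>i<n. 1 - 1 / real p ^ (i + u + 1))"
    by (rule prod.cong) (use * in auto)
  also have "\<dots> = (\<Prod>i<n. \<Prod>p\<in>?F. 1 - 1 / real p ^ (i + u + 1))"
    by (rule prod.swap)
  finally show ?thesis .
qed

section \<open>Euler products\<close>

lemma summable_zeta: "k \<ge> 2 \<Longrightarrow> summable (\<lambda>n. 1 / real (Suc n) ^ k)"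
  using summable_Suc_iff[of "\<lambda>n. inverse (real n ^ k)"] inverse_power_summable[of k, where ?'a = real]
  by (simp add: inverse_eq_divide)

lemma one_le_zeta_nat:
  assumes "k \<ge> 2"
  shows "1 \<le> zeta_nat k"
proof -
  have "(\<Sum>n<1. 1 / real (Suc n) ^ k) \<le> zeta_nat k"
    unfolding zeta_nat_def by (rule sum_le_suminf[OF summable_zeta[OF assms]]) auto
  then show ?thesis by simp
qed

text \<open>The zeta series after striking out the multiples of members of \<open>F\<close>, as in
  the sieve of Eratosthenes. Index \<open>n\<close> stands for the integer
  \<open>Suc n\<close>.\<close>

definition zeta_sieve :: "nat set \<Rightarrow> nat \<Rightarrow> real" where
  "zeta_sieve F s = (\<Sum>n. if \<exists>p\<in>F. p dvd Suc n then 0 else 1 / real (Suc n) ^ s)"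

lemma summable_zeta_sieve:
  assumes "s \<ge> 2"
  shows "summable (\<lambda>n. if P n then 0 else 1 / real (Suc n) ^ s)"
  by (rule summable_comparison_test'[OF summable_zeta[OF assms]]) auto

text \<open>Inserting \<open>q\<close> strikes out the terms at \<open>q * l\<close> with
  \<open>l\<close> divisible by no member of \<open>F\<close>: as \<open>q\<close> is a prime
  outside \<open>F\<close>, it does not affect divisibility by the primes in \<open>F\<close>. These
  terms sum to \<open>1 / q ^ s\<close> times the previous series.\<close>

lemma zeta_sieve_insert:
  assumes "s \<ge> 2" "prime q" "\<And>p. p \<in> F \<Longrightarrow> prime p" "q \<notin> F"
  shows "zeta_sieve (insert q F) s = (1 - 1 / real q ^ s) * zeta_sieve F s"
proof -
  let ?f = "\<lambda>n. if \<exists>p\<in>F. p dvd Suc n then 0 else 1 / real (Suc n) ^ s"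
  let ?g = "\<lambda>n. if q dvd Suc n then ?f n else 0"
  have q: "q > 1" using assms(2) by (rule prime_gt_1_nat)
  have f: "summable ?f" using assms(1) by (rule summable_zeta_sieve)
  have g: "summable ?g" by (rule summable_comparison_test'[OF f]) auto
  \<comment> \<open>\<open>h\<close> lists the indices of the multiples of \<open>q\<close>; 1 is
    subtracted because index \<open>n\<close> stands for \<open>Suc n\<close>.\<close>
  define h where "h n = q * Suc n - 1" for n
  have h: "Suc (h n) = q * Suc n" for n using q by (simp add: h_def)
  have "strict_mono h"
    using q by (intro strict_monoI) (simp add: h_def diff_less_mono)
  moreover have "?g n = 0" if "n \<notin> range h" for n
  proof -
    have "\<not> q dvd Suc n"
    proof
      assume "q dvd Suc n"
      then obtain l where l: "Suc n = q * l" by blast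
      then obtain l' where "l = Suc l'" by (cases l) auto
      then have "n = h l'" using l by (simp add: h_def)
      then show False using that by blast
    qed
    then show ?thesis by simp
  qed
  ultimately have "(\<Sum>n. ?g (h n)) = suminf ?g"
    by (rule suminf_mono_reindex)
  moreover have "?g (h n) = 1 / real q ^ s * ?f n" for n
  proof -
    have "p dvd Suc (h n) \<longleftrightarrow> p dvd Suc n" if "p \<in> F" for p
    proof -
      have "\<not> p dvd q" using that assms by (metis primes_dvd_imp_eq)
      then show ?thesis using assms(3)[OF that] by (simp add: h prime_dvd_mult_iff del: mult_Suc_right)
    qed
    then have "(\<exists>p\<in>F. p dvd Suc (h n)) \<longleftrightarrow> (\<exists>p\<in>F. p dvd Suc n)" by blast
    moreover have "q dvd Suc (h n)" by (simp add: h)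
    moreover have "real (Suc (h n)) = real q * real (Suc n)" by (simp only: h of_nat_mult)
    ultimately show ?thesis by (simp add: power_mult_distrib)
  qed
  ultimately have "suminf ?g = 1 / real q ^ s * suminf ?f"
    using suminf_mult[OF f, of "1 / real q ^ s"] by simp
  moreover have "zeta_sieve (insert q F) s = suminf ?f - suminf ?g"
    unfolding zeta_sieve_def suminf_diff[OF f g] by (rule suminf_cong) auto
  ultimately show ?thesis by (simp add: zeta_sieve_def algebra_simps)
qed

lemma zeta_sieve_eq_prod:
  assumes "s \<ge> 2" "finite F" "\<And>p. p \<in> F \<Longrightarrow> prime p"
  shows "zeta_sieve F s = (\<Prod>p\<in>F. 1 - 1 / real p ^ s) * zeta_nat s"
  using assms(2,3)
proof (induction F rule: finite_induct)
  case empty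
  then show ?case by (simp add: zeta_sieve_def zeta_nat_def)
next
  case (insert q F)
  then show ?case using zeta_sieve_insert[OF assms(1), of q F] by simp
qed

text \<open>By \<open>zeta_sieve_eq_prod\<close> the product is the sieved series divided by zeta.
  Sieving by the primes up to \<open>k\<close> leaves 1 and some terms beyond \<open>k\<close>, so
  the sieved series lies between 1 and 1 plus the tail of the zeta series.\<close>

theorem euler_product_zeta_nat:
  assumes "s \<ge> 2"
  shows "(\<lambda>k. \<Prod>p | prime p \<and> p \<le> k. 1 - 1 / real p ^ s) \<longlonglongrightarrow> inverse (zeta_nat s)"
proof -
  let ?F = "\<lambda>k. {p::nat. prime p \<and> p \<le> k}"
  let ?z = "\<lambda>n. 1 / real (Suc n) ^ s"
  have z: "summable ?z" using assms by (rule summable_zeta)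
  have "(\<lambda>k. zeta_sieve (?F k) s) \<longlonglongrightarrow> 1"
  proof (rule tendsto_sandwich)
    show "\<forall>\<^sub>F k in sequentially. 1 \<le> zeta_sieve (?F k) s"
    proof (intro always_eventually allI)
      fix k
      let ?f = "\<lambda>n. if \<exists>p\<in>?F k. p dvd Suc n then 0 else ?z n"
      have "(\<Sum>n<1. ?f n) \<le> zeta_sieve (?F k) s"
        unfolding zeta_sieve_def by (rule sum_le_suminf[OF summable_zeta_sieve[OF assms]]) auto
      then show "1 \<le> zeta_sieve (?F k) s" by (auto split: if_splits)
    qed
    show "\<forall>\<^sub>F k in sequentially. zeta_sieve (?F k) s \<le> 1 + (zeta_nat s - (\<Sum>n<k. ?z n))"
    proof (intro eventually_sequentiallyI[of 1])
      fix k :: nat assume k: "1 \<le> k"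
      let ?f = "\<lambda>n. if \<exists>p\<in>?F k. p dvd Suc n then 0 else ?z n"
      have f: "summable ?f" using assms by (rule summable_zeta_sieve)
      \<comment> \<open>Among the integers up to \<open>k\<close> only 1 survives, since any other
        has a prime factor at most \<open>k\<close>.\<close>
      have "?f n = (if n = 0 then 1 else 0)" if "n < k" for n
      proof (cases "n = 0")
        case False
        then obtain p where "prime p" "p dvd Suc n"
          using prime_factor_nat[of "Suc n"] by auto
        moreover have "p \<le> k"
          using dvd_imp_le[OF \<open>p dvd Suc n\<close>] that by simp
        ultimately have "\<exists>p\<in>?F k. p dvd Suc n" by blast
        then show ?thesis using False by simp
      qed auto
      then have "(\<Sum>n<k. ?f n) = (\<Sum>n<k. if n = 0 then 1 else 0)" by (intro sum.cong) auto
      then have "(\<Sum>n<k. ?f n) = 1" using k by simp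
      moreover have "zeta_sieve (?F k) s = (\<Sum>n. ?f (n + k)) + (\<Sum>n<k. ?f n)"
        unfolding zeta_sieve_def by (rule suminf_split_initial_segment[OF f])
      moreover have "zeta_nat s = (\<Sum>n. ?z (n + k)) + (\<Sum>n<k. ?z n)"
        unfolding zeta_nat_def by (rule suminf_split_initial_segment[OF z])
      moreover have "(\<Sum>n. ?f (n + k)) \<le> (\<Sum>n. ?z (n + k))"
        using summable_ignore_initial_segment[OF f, of k]
          summable_ignore_initial_segment[OF z, of k]
        by (intro suminf_le) auto
      ultimately show "zeta_sieve (?F k) s \<le> 1 + (zeta_nat s - (\<Sum>n<k. ?z n))" by linarith
    qed
    have "(\<lambda>k. \<Sum>n<k. ?z n) \<longlonglongrightarrow> zeta_nat s"
      unfolding zeta_nat_def using z by (rule summable_LIMSEQ)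
    then have "(\<lambda>k. 1 + (zeta_nat s - (\<Sum>n<k. ?z n))) \<longlonglongrightarrow> 1 + (zeta_nat s - zeta_nat s)"
      by (intro tendsto_intros)
    then show "(\<lambda>k. 1 + (zeta_nat s - (\<Sum>n<k. ?z n))) \<longlonglongrightarrow> 1" by simp
  qed auto
  then have "(\<lambda>k. zeta_sieve (?F k) s / zeta_nat s) \<longlonglongrightarrow> 1 / zeta_nat s"
    using one_le_zeta_nat[OF assms] by (intro tendsto_divide tendsto_const) auto
  moreover have "zeta_sieve (?F k) s / zeta_nat s = (\<Prod>p\<in>?F k. 1 - 1 / real p ^ s)" for k
    using zeta_sieve_eq_prod[OF assms finite_primes_le, of k] one_le_zeta_nat[OF assms] by simp
  ultimately show ?thesis by (simp add: inverse_eq_divide)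
qed

section \<open>The product at exponent 1\<close>

text \<open>A number with all prime factors in \<open>insert q F\<close> either has them in
  \<open>F\<close> or is \<open>q\<close> times a smaller number of the same kind. Hence
  \<open>1 - 1 / q\<close> times the new sum is at most the old one. Truncating at \<open>N\<close>
  keeps all sums finite, at the price of an inequality.\<close>

lemma smooth_harmonic_le:
  assumes "finite F" "\<And>p. p \<in> F \<Longrightarrow> prime p"
  shows "(\<Prod>p\<in>F. 1 - 1 / real p) * (\<Sum>n | n \<in> {1..N} \<and> prime_factors n \<subseteq> F. 1 / real n) \<le> 1"
  using assms
proof (induction F rule: finite_induct)
  case empty
  have "{n. n \<in> {1..N} \<and> prime_factors n \<subseteq> {}} \<subseteq> {1}"
    by (auto simp: prime_factorization_empty_iff)
  then have "(\<Sum>n | n \<in> {1..N} \<and> prime_factors n \<subseteq> {}. 1 / real n) \<le> (\<Sum>n\<in>{1}. 1 / real n)"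
    by (intro sum_mono2) auto
  then show ?case by simp
next
  case (insert q F)
  let ?S = "\<lambda>F. {n. n \<in> {1..N} \<and> prime_factors n \<subseteq> F}"
  let ?T = "\<lambda>F. \<Sum>n\<in>?S F. 1 / real n"
  have q: "prime q" using insert by simp
  have q1: "q > 1" using q by (rule prime_gt_1_nat)
  have fin: "finite (?S G)" for G by (rule finite_subset[of _ "{1..N}"]) auto
  have "?S (insert q F) \<subseteq> ?S F \<union> (\<lambda>n. q * n) ` ?S (insert q F)"
  proof
    fix n assume n: "n \<in> ?S (insert q F)"
    show "n \<in> ?S F \<union> (\<lambda>n. q * n) ` ?S (insert q F)"
    proof (cases "q dvd n")
      case True
      then obtain l where l: "n = q * l" by blast
      then have "l dvd n" "l \<le> n" "l > 0" using n q1 by (auto intro!: Nat.gr0I)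
      then have "l \<in> ?S (insert q F)"
        using n dvd_prime_factors[of n l] by auto
      then show ?thesis using l by blast
    next
      case False
      then have "q \<notin> prime_factors n" by auto
      then show ?thesis using n by blast
    qed
  qed
  then have "?T (insert q F) \<le> (\<Sum>n \<in> ?S F \<union> (\<lambda>n. q * n) ` ?S (insert q F). 1 / real n)"
    using fin by (intro sum_mono2) auto
  also have "\<dots> \<le> ?T F + (\<Sum>n \<in> (\<lambda>n. q * n) ` ?S (insert q F). 1 / real n)"
    using fin by (simp add: sum_Un sum_nonneg)
  also have "(\<Sum>n \<in> (\<lambda>n. q * n) ` ?S (insert q F). 1 / real n)
      = (\<Sum>n \<in> ?S (insert q F). 1 / real (q * n))"
    using q1 by (subst sum.reindex) (auto simp: inj_on_def)
  also have "\<dots> = 1 / real q * ?T (insert q F)"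
    by (simp add: sum_distrib_left)
  finally have "(1 - 1 / real q) * ?T (insert q F) \<le> ?T F"
    by (simp add: algebra_simps)
  moreover have "0 \<le> (\<Prod>p\<in>F. 1 - 1 / real p)"
  proof (rule prod_nonneg)
    fix p assume "p \<in> F"
    then have "p \<ge> 1" using insert.prems prime_ge_1_nat by blast
    then show "0 \<le> 1 - 1 / real p" by (simp add: divide_le_eq_1)
  qed
  ultimately have "(\<Prod>p\<in>F. 1 - 1 / real p) * ((1 - 1 / real q) * ?T (insert q F))
      \<le> (\<Prod>p\<in>F. 1 - 1 / real p) * ?T F"
    by (rule mult_left_mono)
  also have "\<dots> \<le> 1" using insert by simp
  finally show ?case using insert(1,2) by (simp add: mult_ac)
qed

text \<open>All prime factors of 1, ..., \<open>k\<close> are at most \<open>k\<close>, so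
  \<open>smooth_harmonic_le\<close> bounds the product by the inverse of a harmonic number, which
  tends to 0.\<close>

theorem prod_primes_tendsto_zero:
  "(\<lambda>k. \<Prod>p | prime p \<and> p \<le> k. 1 - 1 / real p) \<longlonglongrightarrow> 0"
proof (rule tendsto_sandwich)
  let ?P = "\<lambda>k. \<Prod>p | prime p \<and> p \<le> k. 1 - 1 / real p"
  let ?H = "\<lambda>k. \<Sum>n=1..k. 1 / real n"
  show "\<forall>\<^sub>F k in sequentially. 0 \<le> ?P k"
    by (intro always_eventually allI prod_nonneg)
      (auto simp: field_simps dest: prime_gt_0_nat)
  show "\<forall>\<^sub>F k in sequentially. ?P k \<le> inverse (?H k)"
  proof (intro eventually_sequentiallyI[of 1])
    fix k :: nat assume k: "1 \<le> k"
    have "p \<le> k" if "n \<in> {1..k}" "p dvd n" for n p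
      using that dvd_imp_le[of p n] by simp
    then have "{n. n \<in> {1..k} \<and> prime_factors n \<subseteq> {p. prime p \<and> p \<le> k}} = {1..k}"
      by (auto simp: in_prime_factors_iff)
    then have "?P k * ?H k \<le> 1"
      using smooth_harmonic_le[OF finite_primes_le, of k k] by simp
    moreover have "?H k > 0"
      using k by (intro sum_pos) auto
    ultimately show "?P k \<le> inverse (?H k)"
      by (simp add: field_simps)
  qed
  have "filterlim (harm :: nat \<Rightarrow> real) at_top sequentially"
    by (rule harm_at_top)
  moreover have "harm = ?H"
    by (rule ext) (simp add: harm_def inverse_eq_divide)
  ultimately have "filterlim ?H at_top sequentially"
    by simp
  then show "(\<lambda>k. inverse (?H k)) \<longlonglongrightarrow> 0"
    by (rule tendsto_inverse_0_at_top)
qed auto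

section \<open>Convergence of the product of inverse zeta values\<close>

text \<open>Compare the terms at integers from 2 on with those of zeta at 2: each of the remaining
  \<open>k - 2\<close> powers contributes a factor at most 1/2. This geometric decay makes the
  infinite product converge.\<close>

lemma zeta_nat_le:
  assumes "k \<ge> 2"
  shows "zeta_nat k - 1 \<le> zeta_nat 2 * (1 / 2) ^ (k - 2)"
proof -
  let ?z = "\<lambda>k n. 1 / real (Suc n) ^ k"
  have z: "summable (?z k)" "summable (?z 2)" by (rule summable_zeta[OF assms], rule summable_zeta[OF order_refl])
  have z': "summable (\<lambda>n. ?z k (Suc n))" "summable (\<lambda>n. ?z 2 (Suc n))"
    using z by (simp_all only: summable_Suc_iff[of "?z k"] summable_Suc_iff[of "?z 2"])
  have "zeta_nat k - 1 = (\<Sum>n. ?z k (Suc n))"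
    unfolding zeta_nat_def using suminf_split_head[OF z(1)] by simp
  also have "\<dots> \<le> (\<Sum>n. (1 / 2) ^ (k - 2) * ?z 2 (Suc n))"
  proof (rule suminf_le)
    fix n
    have "?z k (Suc n) = (1 / real (Suc (Suc n))) ^ (k - 2 + 2)"
      by (simp only: le_add_diff_inverse2[OF assms] power_one_over)
    also have "\<dots> = (1 / real (Suc (Suc n))) ^ (k - 2) * ?z 2 (Suc n)"
      by (simp only: power_add power_one_over)
    also have "\<dots> \<le> (1 / 2) ^ (k - 2) * ?z 2 (Suc n)"
      by (intro mult_right_mono power_mono) (auto simp: field_simps)
    finally show "?z k (Suc n) \<le> (1 / 2) ^ (k - 2) * ?z 2 (Suc n)" .
  qed (rule z'(1), rule summable_mult[OF z'(2)])
  also have "\<dots> = (1 / 2) ^ (k - 2) * (\<Sum>n. ?z 2 (Suc n))"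
    using z'(2) by (rule suminf_mult)
  also have "(\<Sum>n. ?z 2 (Suc n)) \<le> zeta_nat 2"
    unfolding zeta_nat_def using suminf_split_head[OF z(2)] by simp
  finally show ?thesis by (simp add: mult.commute)
qed

text \<open>Convergence is what identifies the infinite product with the limit of its partial
  products. It follows from summability of \<open>zeta_nat (k + u + 1) - 1\<close>, where
  \<open>u > 0\<close> keeps every argument at least 2 and the exponent in the geometric bound at
  least \<open>k\<close>.\<close>

lemma convergent_prod_inverse_zeta_nat:
  assumes "u > 0"
  shows "convergent_prod (\<lambda>k. inverse (zeta_nat (k + u + 1)))"
proof -
  have "summable (\<lambda>k. zeta_nat 2 * (1 / 2) ^ k)"
    by (intro summable_mult summable_geometric) simp
  moreover have "norm (norm (zeta_nat (k + u + 1) - 1)) \<le> zeta_nat 2 * (1 / 2) ^ k" for k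
  proof -
    have "zeta_nat (k + u + 1) - 1 \<le> zeta_nat 2 * (1 / 2) ^ (k + u + 1 - 2)"
      using assms by (intro zeta_nat_le) simp
    also have "\<dots> \<le> zeta_nat 2 * (1 / 2) ^ k"
      using assms one_le_zeta_nat[of 2] by (intro mult_left_mono power_decreasing) auto
    finally show ?thesis
      using one_le_zeta_nat[of "k + u + 1"] assms by simp
  qed
  ultimately have "summable (\<lambda>k. norm (zeta_nat (k + u + 1) - 1))"
    by (rule summable_comparison_test'[where N = 0])
  then show ?thesis
    by (intro convergent_prod_inverse abs_convergent_prod_imp_convergent_prod
        summable_imp_abs_convergent_prod)
qed

section \<open>Haar measure\<close>

lemma sets_Zhat_cylinder: "{f \<in> Zhat. f m = a} \<in> sets Zhat_borel"
proof -
  let ?P = "PiM UNIV (\<lambda>_::nat. count_space (UNIV :: int set))"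
  have "(\<lambda>f. f m) -` {a} \<inter> space ?P \<in> sets ?P"
    by (rule measurable_sets[OF measurable_component_singleton]) auto
  then have "Zhat \<inter> {f. f m = a} \<in> sets Zhat_borel"
    unfolding Zhat_borel_def sets_restrict_space by (auto simp: space_PiM vimage_def)
  then show ?thesis by (simp add: Int_def)
qed

text \<open>The fibres of reduction modulo \<open>m\<close> are translates of each other.\<close>

lemma measure_Zhat_cylinder:
  assumes \<mu>: "haar_Zhat \<mu>" and a: "0 \<le> a" "a < int m"
  shows "measure \<mu> {f \<in> Zhat. f m = a} = 1 / real m"
proof -
  interpret prob_space \<mu> using \<mu> by (simp add: haar_Zhat_def)
  let ?B = "\<lambda>a. {f \<in> Zhat. f m = a}"
  have m: "m > 0" using a by linarith
  have sets: "?B b \<in> sets \<mu>" for b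
    using \<mu> sets_Zhat_cylinder by (simp add: haar_Zhat_def)
  have translate: "zadd (zhat_of_int b) ` ?B 0 = ?B b" if b: "0 \<le> b" "b < int m" for b
  proof
    have zadd_in: "zadd (zhat_of_int c) f \<in> Zhat" if f: "f \<in> Zhat" for c f
    proof -
      have "zadd (zhat_of_int c) f d = zadd (zhat_of_int c) f k mod int d"
        if "0 < k" "d dvd k" for d k
      proof -
        have "d > 0" using that by (auto intro: Nat.gr0I)
        have "[f k = f d] (mod int d)" using f that by (rule Zhat_cong)
        then have "[c mod int k + f k = c mod int d + f d] (mod int d)"
          using that by (intro cong_add) (auto simp: cong_def mod_mod_cancel)
        then show ?thesis
          using that \<open>d > 0\<close> by (simp add: zadd_def zhat_of_int_def cong_def mod_mod_cancel)
      qed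
      moreover have "zadd (zhat_of_int c) f 0 = 0"
        "\<forall>k>0. 0 \<le> zadd (zhat_of_int c) f k \<and> zadd (zhat_of_int c) f k < int k"
        by (simp_all add: zadd_def)
      ultimately show ?thesis unfolding Zhat_def by blast
    qed
    show "zadd (zhat_of_int b) ` ?B 0 \<subseteq> ?B b"
      using zadd_in m b by (auto simp: zadd_def zhat_of_int_def)
    show "?B b \<subseteq> zadd (zhat_of_int b) ` ?B 0"
    proof
      fix f assume f: "f \<in> ?B b"
      \<comment> \<open>Translating back by \<open>- b\<close> produces the preimage.\<close>
      let ?g = "zadd (zhat_of_int (- b)) f"
      have "?g \<in> ?B 0"
        using zadd_in f m by (auto simp: zadd_def zhat_of_int_def mod_simps)
      moreover have "zadd (zhat_of_int b) ?g = f"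
      proof
        fix k
        show "zadd (zhat_of_int b) ?g k = f k"
          using f Zhat_mod_self[of f k] Zhat_zero[of f]
          by (cases "k = 0") (auto simp: zadd_def zhat_of_int_def mod_simps)
      qed
      ultimately show "f \<in> zadd (zhat_of_int b) ` ?B 0"
        by (intro image_eqI[of _ _ ?g]) simp_all
    qed
  qed
  have eq: "measure \<mu> (?B b) = measure \<mu> (?B 0)" if "0 \<le> b" "b < int m" for b
  proof -
    have "emeasure \<mu> (zadd (zhat_of_int b) ` ?B 0) = emeasure \<mu> (?B 0)"
      using \<mu> zhat_of_int_in_Zhat sets unfolding haar_Zhat_def by blast
    then show ?thesis using translate[OF that] by (simp add: measure_def)
  qed
  \<comment> \<open>The \<open>m\<close> fibres partition the space, so their common measure is
    \<open>1 / m\<close>.\<close>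
  have "(\<Union>b\<in>{0..<int m}. ?B b) = space \<mu>"
    using \<mu> Zhat_bounds[OF _ m] unfolding haar_Zhat_def by blast
  then have "1 = measure \<mu> (\<Union>b\<in>{0..<int m}. ?B b)"
    by (simp add: prob_space)
  also have "\<dots> = (\<Sum>b\<in>{0..<int m}. measure \<mu> (?B b))"
    using sets by (intro finite_measure_finite_Union) (auto simp: disjoint_family_on_def)
  also have "\<dots> = (\<Sum>b\<in>{0..<int m}. measure \<mu> (?B 0))"
    by (rule sum.cong[OF refl], rule eq) simp_all
  also have "\<dots> = real m * measure \<mu> (?B 0)"
    by simp
  finally show ?thesis using eq[OF a] m by (simp add: field_simps)
qed

text \<open>The event is a finite disjoint union of boxes \<open>?C M\<close>, one for each
  surjective residue matrix \<open>M\<close>. A box fixes the residue of every entry, so in the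
  product measure it has mass \<open>1 / m\<close> to the number of entries.\<close>

lemma
  fixes n :: nat
  assumes \<mu>: "haar_Zhat \<mu>" and J: "finite J" and m: "m > 0"
  defines "P \<equiv> PiM ({..<n} \<times> J) (\<lambda>_. \<mu>)"
  shows sets_surj_mod: "{A \<in> space P. surj_mod m n J (\<lambda>s. A s m)} \<in> sets P" (is "?E \<in> _")
    and measure_surj_mod: "measure P {A \<in> space P. surj_mod m n J (\<lambda>s. A s m)}
      = real (card (surj_mats m n J)) / real m ^ (n * card J)"
proof -
  let ?S = "{..<n} \<times> J"
  have S: "finite ?S" using J by simp
  interpret M: prob_space \<mu> using \<mu> by (simp add: haar_Zhat_def)
  interpret P: finite_product_prob_space "\<lambda>_. \<mu>" ?S
    by unfold_locales (rule S)
  let ?C = "\<lambda>M. \<Pi>\<^sub>E s\<in>?S. {f \<in> Zhat. f m = M s}"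
  have cyl: "{f \<in> Zhat. f m = a} \<in> sets \<mu>" for a
    using \<mu> sets_Zhat_cylinder by (simp add: haar_Zhat_def)
  have space_P: "space P = ?S \<rightarrow>\<^sub>E Zhat"
    using \<mu> by (simp add: P_def space_PiM haar_Zhat_def)
  have C_sets: "?C M \<in> sets P" for M
    unfolding P_def using S cyl by (intro sets_PiM_I_finite) auto
  have "?E = (\<Union>M\<in>surj_mats m n J. ?C M)"
  proof
    show "?E \<subseteq> (\<Union>M\<in>surj_mats m n J. ?C M)"
    proof
      fix A assume A: "A \<in> ?E"
      let ?M = "\<lambda>s\<in>?S. A s m"
      have "surj_mod m n J ?M \<longleftrightarrow> surj_mod m n J (\<lambda>s. A s m)"
        by (rule surj_mod_cong) simp
      moreover have "A s m \<in> {0..<int m}" if "s \<in> ?S" for s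
      proof -
        have "A s \<in> Zhat" using A that unfolding space_P by blast
        then show ?thesis using m by (rule Zhat_bounds)
      qed
      then have "?M \<in> mats m n J"
        unfolding mats_def by (rule restrict_PiE_iff[THEN iffD2, rule_format])
      ultimately have "?M \<in> surj_mats m n J" using A by (simp add: surj_mats_def)
      moreover have "A \<in> ?C ?M"
        using A unfolding space_P by (auto simp: PiE_iff)
      ultimately show "A \<in> (\<Union>M\<in>surj_mats m n J. ?C M)" by blast
    qed
    show "(\<Union>M\<in>surj_mats m n J. ?C M) \<subseteq> ?E"
    proof
      fix A assume "A \<in> (\<Union>M\<in>surj_mats m n J. ?C M)"
      then obtain M where M: "M \<in> surj_mats m n J" "A \<in> ?C M" by blast
      have "A \<in> space P" using M(2) unfolding space_P by (auto simp: PiE_iff)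
      moreover have "surj_mod m n J M \<longleftrightarrow> surj_mod m n J (\<lambda>s. A s m)"
        using M(2) by (intro surj_mod_cong) (auto simp: PiE_iff)
      ultimately show "A \<in> ?E" using M(1) by (simp add: surj_mats_def)
    qed
  qed
  note E = this
  have fin: "finite (surj_mats m n J)" using J by (rule finite_surj_mats)
  show "?E \<in> sets P"
    unfolding E using fin C_sets by blast
  have disj: "disjoint_family_on ?C (surj_mats m n J)"
    unfolding disjoint_family_on_def
  proof (intro ballI impI)
    fix M M' assume M: "M \<in> surj_mats m n J" "M' \<in> surj_mats m n J" "M \<noteq> M'"
    have "M = M'" if A: "A \<in> ?C M" "A \<in> ?C M'" for A
    proof (rule PiE_ext)
      show "M \<in> ?S \<rightarrow>\<^sub>E {0..<int m}" "M' \<in> ?S \<rightarrow>\<^sub>E {0..<int m}"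
        using M by (simp_all add: surj_mats_def mats_def)
      show "M s = M' s" if "s \<in> ?S" for s
        using PiE_mem[OF A(1) that] PiE_mem[OF A(2) that] by simp
    qed
    then show "?C M \<inter> ?C M' = {}" using M(3) by blast
  qed
  have C: "measure P (?C M) = 1 / real m ^ (n * card J)" if M: "M \<in> surj_mats m n J" for M
  proof -
    have "measure P (?C M) = (\<Prod>s\<in>?S. measure \<mu> {f \<in> Zhat. f m = M s})"
      unfolding P_def using cyl by (intro P.finite_measure_PiM_emb)
    also have "\<dots> = (\<Prod>s\<in>?S. 1 / real m)"
    proof (rule prod.cong)
      fix s assume "s \<in> ?S"
      then have "M s \<in> {0..<int m}"
        using M PiE_mem[of M ?S "\<lambda>_. {0..<int m}" s] unfolding surj_mats_def mats_def by blast
      then show "measure \<mu> {f \<in> Zhat. f m = M s} = 1 / real m"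
        using measure_Zhat_cylinder[OF \<mu>] by simp
    qed simp
    finally show ?thesis by (simp add: card_cartesian_product power_one_over)
  qed
  have "measure P ?E = (\<Sum>M\<in>surj_mats m n J. measure P (?C M))"
    unfolding E using fin C_sets disj P.emeasure_finite
    by (intro measure_finite_Union) (auto simp: P_def)
  also have "\<dots> = real (card (surj_mats m n J)) / real m ^ (n * card J)"
    using C by simp
  finally show "measure P ?E = real (card (surj_mats m n J)) / real m ^ (n * card J)" .
qed

section \<open>Passage to the limit\<close>

text \<open>Continuity from above: the events of surjectivity modulo \<open>primorial k\<close>
  decrease in \<open>k\<close>, and by \<open>zhat_surj_iff\<close> their intersection is
  surjectivity over \<open>Zhat\<close>.\<close>

theorem surj_prob_limit:
  assumes \<mu>: "haar_Zhat \<mu>"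
  shows "(\<lambda>k. \<Prod>i<n. \<Prod>p | prime p \<and> p \<le> k. 1 - 1 / real p ^ (i + u + 1))
    \<longlonglongrightarrow> surj_prob \<mu> u n"
proof -
  let ?J = "{..<n + u}"
  define P where "P = PiM ({..<n} \<times> ?J) (\<lambda>_. \<mu>)"
  interpret M: prob_space \<mu> using \<mu> by (simp add: haar_Zhat_def)
  interpret P: prob_space P
    unfolding P_def by (rule prob_space_PiM) (rule M.prob_space_axioms)
  define E where "E k = {A \<in> space P. surj_mod (primorial k) n ?J (\<lambda>s. A s (primorial k))}" for k
  have sets: "E k \<in> sets P" for k
    unfolding E_def P_def using \<mu> primorial_pos by (intro sets_surj_mod) auto
  have Zhat: "A (i, j) \<in> Zhat" if "A \<in> space P" "i < n" "j \<in> ?J" for A i j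
    using that \<mu> by (auto simp: P_def space_PiM haar_Zhat_def PiE_iff)
  have "decseq E"
  proof (rule decseq_SucI)
    fix k
    show "E (Suc k) \<subseteq> E k"
    proof
      fix A assume A: "A \<in> E (Suc k)"
      then have "surj_mod (primorial (Suc k)) n ?J (\<lambda>s. A s (primorial (Suc k)))"
        by (simp add: E_def)
      then have "surj_mod (primorial k) n ?J (\<lambda>s. A s (primorial (Suc k)))"
        by (rule surj_mod_dvd) (simp add: primorial_dvd)
      then have "surj_mod (primorial k) n ?J (\<lambda>s. A s (primorial k))"
        using surj_mod_level[of n ?J A "primorial (Suc k)" "primorial k"] Zhat A
          primorial_pos primorial_dvd[of k "Suc k"] by (simp add: E_def)
      then show "A \<in> E k" using A by (simp add: E_def)
    qed
  qed
  then have "(\<lambda>k. measure P (E k)) \<longlonglongrightarrow> measure P (\<Inter>k. E k)"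
    using sets by (intro P.finite_Lim_measure_decseq) auto
  moreover have "(\<Inter>k. E k) = {A \<in> space P. zhat_surj n (n + u) A}"
    using zhat_surj_iff[of n "n + u"] Zhat unfolding E_def by auto
  then have "measure P (\<Inter>k. E k) = surj_prob \<mu> u n"
    by (simp add: surj_prob_def P_def)
  moreover have "measure P (E k)
      = (\<Prod>i<n. \<Prod>p | prime p \<and> p \<le> k. 1 - 1 / real p ^ (i + u + 1))" for k
    using measure_surj_mod[OF \<mu> _ primorial_pos, of ?J n k]
      surj_mats_density_primorial[of ?J n u k] by (simp add: E_def P_def)
  ultimately show ?thesis by simp
qed

theorem theorem6:
  fixes \<mu> :: "(nat \<Rightarrow> int) measure" and u :: nat
  assumes "haar_Zhat \<mu>"
  shows "(u > 0 \<longrightarrow>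
           (\<lambda>n. surj_prob \<mu> u n) \<longlonglongrightarrow> (\<Prod>k. inverse (zeta_nat (k + u + 1))))
       \<and> (u = 0 \<longrightarrow> (\<lambda>n. surj_prob \<mu> u n) \<longlonglongrightarrow> 0)"
proof (intro conjI impI)
  assume u: "u > 0"
  \<comment> \<open>For fixed \<open>n\<close> the limit over the primes is taken factor by factor,
    all exponents being at least 2. The probability is thus exactly a partial product.\<close>
  have "surj_prob \<mu> u n = (\<Prod>i<n. inverse (zeta_nat (i + u + 1)))" for n
  proof (rule LIMSEQ_unique[OF surj_prob_limit[OF assms]])
    show "(\<lambda>k. \<Prod>i<n. \<Prod>p | prime p \<and> p \<le> k. 1 - 1 / real p ^ (i + u + 1))
        \<longlonglongrightarrow> (\<Prod>i<n. inverse (zeta_nat (i + u + 1)))"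
      using u by (intro tendsto_prod euler_product_zeta_nat) simp
  qed
  \<comment> \<open>\<open>convergent_prod_LIMSEQ\<close> concerns products over
    \<open>i \<le> n\<close>, hence the shift to \<open>Suc n\<close>.\<close>
  moreover have "(\<lambda>n. \<Prod>i\<le>n. inverse (zeta_nat (i + u + 1)))
      \<longlonglongrightarrow> (\<Prod>k. inverse (zeta_nat (k + u + 1)))"
    using convergent_prod_inverse_zeta_nat[OF u] by (rule convergent_prod_LIMSEQ)
  ultimately have "(\<lambda>n. surj_prob \<mu> u (Suc n)) \<longlonglongrightarrow> (\<Prod>k. inverse (zeta_nat (k + u + 1)))"
    by (simp add: lessThan_Suc_atMost)
  then show "(\<lambda>n. surj_prob \<mu> u n) \<longlonglongrightarrow> (\<Prod>k. inverse (zeta_nat (k + u + 1)))"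
    by (rule LIMSEQ_imp_Suc)
next
  assume u: "u = 0"
  \<comment> \<open>The probability is 0 at every positive size already. Size 0 is left out: the
    empty matrix is surjective.\<close>
  have "surj_prob \<mu> 0 (Suc n) = 0" for n
  proof (rule LIMSEQ_unique[OF surj_prob_limit[OF assms]])
    let ?Q = "\<lambda>s k. \<Prod>p | prime p \<and> p \<le> k. 1 - 1 / real p ^ s"
    \<comment> \<open>The factor of exponent 1 is split off and tends to 0; the others have
      exponents at least 2 and converge, so the whole product tends to 0.\<close>
    have "(\<lambda>k. \<Prod>i<n. ?Q (Suc i + 0 + 1) k) \<longlonglongrightarrow> (\<Prod>i<n. inverse (zeta_nat (Suc i + 0 + 1)))"
      by (intro tendsto_prod euler_product_zeta_nat) simp
    with prod_primes_tendsto_zero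
    have "(\<lambda>k. (\<Prod>p | prime p \<and> p \<le> k. 1 - 1 / real p) * (\<Prod>i<n. ?Q (Suc i + 0 + 1) k))
        \<longlonglongrightarrow> 0 * (\<Prod>i<n. inverse (zeta_nat (Suc i + 0 + 1)))"
      by (rule tendsto_mult)
    then show "(\<lambda>k. \<Prod>i<Suc n. ?Q (i + 0 + 1) k) \<longlonglongrightarrow> 0"
      by (simp only: prod.lessThan_Suc_shift) simp
  qed
  then have "(\<lambda>n. surj_prob \<mu> u (Suc n)) \<longlonglongrightarrow> 0" by (simp add: u)
  then show "(\<lambda>n. surj_prob \<mu> u n) \<longlonglongrightarrow> 0"
    by (rule LIMSEQ_imp_Suc)
qed

end
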